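(* For every integer $n\geq 0$, (i) $\displaystyle \sum_{j=-\infty}^\infty (-1)^j\, Q_2\big(n-j(3j-1)/2\big) = \begin{cases}\rho_k, & \text{if } n=k(k+1) \text{ for some } k\in\mathbb{N}_0,\\ 0, & \text{otherwise;}\end{cases}$ (ii) $\displaystyle \sum_{j=-\infty}^\infty (-1)^j\, Q_2\big(n-3j(3j-1)/2\big) = \begin{cases}1, & \text{if } n=k(3k-2) \text{ for some } k\in\mathbb{Z},\\ 0, & \text{otherwise.}\end{cases}$
   Context: $Q_2(n)$ denotes the number of partitions of $n$ into distinct parts which are not congruent to $\pm 2$ modulo $6$, with $Q_2(0)=1$ and $Q_2(n)=0$ for $n<0$. For any integer $k$, $\rho_k:=-2$ if $k\equiv 1\pmod 3$, and $\rho_k:=1$ otherwise. $\mathbb{N}_0$ is the set of nonnegative integers. *)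

theory Defs
  imports "HOL-Analysis.Analysis" "HOL-Number_Theory.Cong"
begin

text \<open>A partition into distinct parts is a finite set of positive integers. For
  \<open>n = 0\<close> only the empty set counts, so \<open>Q2 0 = 1\<close>; for negative \<open>n\<close> there is none,
  so \<open>Q2 n = 0\<close>. The counted sets form a subset of \<open>Pow {1..nat n}\<close>, so \<open>card\<close> is
  never applied to an infinite set.\<close>

definition Q2 :: "int \<Rightarrow> nat" where
  "Q2 n = card {A :: nat set. finite A \<and>
     (\<forall>a\<in>A. a > 0 \<and> \<not> [int a = 2] (mod 6) \<and> \<not> [int a = -2] (mod 6)) \<and>
     int (\<Sum>A) = n}"

definition rho :: "int \<Rightarrow> int" where
  "rho k = (if [k = 1] (mod 3) then -2 else 1)"

end

(* The generating function of Q2 is (-q;q^2) (-q^6;q^6), where (a;p) is the infinite product of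
   the 1 - a p^k. By the pentagonal number theorem the two sums are the coefficients of its
   products with (q;q) and with (q^3;q^3). Split these factors by residues and use Euler's identity
   (q;q^2) (-q;q) = 1.
   (i) With Q = q^2 and w a primitive cube root of unity,
   (1 + x)(1 - x + x^2) = 1 + x^3 and 1 - x + x^2 = (1 + wx)(1 + x/w) leave
   (Q;Q) (-wQ;Q) (-Q/w;Q), which up to the factor 1 + 1/w is the theta series
   sum w^j Q^(j(j+1)/2). The terms j = k and j = -k-1 combine to the coefficient rho k.
   (ii) The product collapses to (q^6;q^6) (-q;q^6) (-q^5;q^6), the theta series
   sum q^(j(3j-2)).
   All theta series come from Jacobi's triple product, proved as a finite identity with
   q-binomial coefficients and then read modulo a power of q. *)

theory Submission
  imports Defs "HOL-Computational_Algebra.Formal_Power_Series"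
begin

unbundle no vec_syntax and fps_syntax

section \<open>Gaussian binomial coefficients\<close>

text \<open>Defined by a Pascal rule instead of a quotient, so that it makes sense in every
  commutative ring.\<close>

fun qbinomial :: "'a::comm_ring_1 \<Rightarrow> nat \<Rightarrow> nat \<Rightarrow> 'a" where
  "qbinomial p n 0 = 1"
| "qbinomial p 0 (Suc k) = 0"
| "qbinomial p (Suc n) (Suc k) = qbinomial p n k + p ^ Suc k * qbinomial p n (Suc k)"

text \<open>The Pochhammer product (p;p)_n, that is, the q-factorial without its denominator (1 -
  p)^n.\<close>

definition qfact :: "'a::comm_ring_1 \<Rightarrow> nat \<Rightarrow> 'a" where
  "qfact p n = (\<Prod>k<n. 1 - p ^ Suc k)"

lemma qbinomial_eq_0: "n < k \<Longrightarrow> qbinomial p n k = 0"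
  by (induction p n k rule: qbinomial.induct) auto

text \<open>The mirror image of the defining Pascal rule. Expand by the defining rule, apply the
  induction hypothesis to both terms and regroup by the defining rule.\<close>

lemma qbinomial_Suc_Suc':
  assumes "k \<le> n"
  shows "qbinomial p (Suc n) (Suc k) = p ^ (n - k) * qbinomial p n k + qbinomial p n (Suc k)"
  using assms
proof (induction n arbitrary: k)
  case 0
  then show ?case by simp
next
  case (Suc n)
  show ?case
  proof (cases k)
    case 0
    have "qbinomial p (Suc n) (Suc 0) = p ^ n + qbinomial p n (Suc 0)"
      using Suc.IH[of 0] by simp
    moreover have "qbinomial p (Suc n) (Suc 0) = 1 + p * qbinomial p n (Suc 0)"
      by simp
    moreover have "qbinomial p (Suc (Suc n)) (Suc 0) = 1 + p * qbinomial p (Suc n) (Suc 0)"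
      by simp
    ultimately have "qbinomial p (Suc (Suc n)) (Suc 0) = p ^ Suc n + qbinomial p (Suc n) (Suc 0)"
      by (metis (no_types, opaque_lifting) add.left_commute distrib_left power_Suc)
    then show ?thesis using 0 by (simp del: qbinomial.simps(3))
  next
    case k: (Suc l)
    have l: "l \<le> n" using Suc.prems k by simp
    show ?thesis
    proof (cases "k = Suc n")
      case True
      then show ?thesis by (simp add: qbinomial_eq_0)
    next
      case False
      then have kn: "k \<le> n" using Suc.prems by simp
      \<comment> \<open>Both sides are \<open>p ^ Suc n\<close>, since
        \<open>k = Suc l\<close>.\<close>
      have e: "p ^ Suc k * p ^ (n - k) = p ^ (n - l) * p ^ k"
        using kn k by (simp add: algebra_simps flip: power_add power_Suc)
      have "qbinomial p (Suc (Suc n)) (Suc k)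
          = (p ^ (n - l) * qbinomial p n l + qbinomial p n k)
            + p ^ Suc k * (p ^ (n - k) * qbinomial p n k + qbinomial p n (Suc k))"
        using Suc.IH[OF l] Suc.IH[OF kn] k by (metis qbinomial.simps(3))
      also have "\<dots> = p ^ (n - l) * (qbinomial p n l + p ^ k * qbinomial p n k)
            + (qbinomial p n k + p ^ Suc k * qbinomial p n (Suc k))"
        using arg_cong[OF e, of "\<lambda>x. x * qbinomial p n k"]
        by (simp add: algebra_simps del: power_Suc)
      also have "\<dots> = p ^ (Suc n - k) * qbinomial p (Suc n) k + qbinomial p (Suc n) (Suc k)"
        using k by simp
      finally show ?thesis .
    qed
  qed
qed

lemma qfact_Suc: "qfact p (Suc n) = (1 - p ^ Suc n) * qfact p n"
  by (simp add: qfact_def mult.commute)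

text \<open>The quotient formula, free of division. The Pascal rule reduces it to (1 - p^k) + p^k (1
  - p^(n+1-k)) = 1 - p^(n+1).\<close>

lemma qbinomial_qfact:
  assumes "k \<le> n"
  shows "qfact p k * qfact p (n - k) * qbinomial p n k = qfact p n"
  using assms
proof (induction n arbitrary: k)
  case 0
  then show ?case by (simp add: qfact_def)
next
  case (Suc n)
  show ?case
  proof (cases k)
    case 0
    then show ?thesis by (simp add: qfact_def)
  next
    case k: (Suc l)
    have l: "l \<le> n" using Suc.prems k by simp
    have 1: "qfact p l * qfact p (n - l) * qbinomial p n l = qfact p n"
      by (rule Suc.IH[OF l])
    have 2: "qfact p k * qfact p (n - l) * qbinomial p n k = (1 - p ^ (n - l)) * qfact p n"
    \<comment> \<open>For \<open>l = n\<close> both sides vanish; otherwise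
      \<open>qfact p (n - l)\<close> has just one factor more than the induction hypothesis for
      \<open>k\<close> provides.\<close>
    proof (cases "l = n")
      case True
      then show ?thesis by (simp add: k qbinomial_eq_0)
    next
      case False
      then have kn: "k \<le> n" and s: "n - l = Suc (n - k)" using l k by simp_all
      show ?thesis unfolding s qfact_Suc Suc.IH[OF kn, symmetric] by (simp add: ac_simps)
    qed
    have e: "p ^ Suc n = p ^ k * p ^ (n - l)" using l k by (simp flip: power_add power_Suc)
    have "qfact p k * qfact p (Suc n - k) * qbinomial p (Suc n) k
        = (1 - p ^ k) * (qfact p l * qfact p (n - l) * qbinomial p n l)
          + p ^ k * (qfact p k * qfact p (n - l) * qbinomial p n k)"
      using k by (simp add: qfact_Suc algebra_simps)
    also have "\<dots> = qfact p (Suc n)"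
      unfolding 1 2 qfact_Suc e by (simp add: algebra_simps)
    finally show ?thesis .
  qed
qed

section \<open>Triangular numbers and the finite triple product\<close>

text \<open>The product \<open>j * (j + 1)\<close> is nonnegative and even for every integer
  \<open>j\<close>, so neither \<open>nat\<close> nor \<open>div\<close> loses anything, and the
  value can serve as an exponent.\<close>

definition tri :: "int \<Rightarrow> nat" where
  "tri j = nat (j * (j + 1) div 2)"

lemma int_tri: "2 * int (tri j) = j * (j + 1)"
proof -
  have "0 \<le> j * (j + 1)" by (cases "j \<ge> 0") (auto simp: mult_nonpos_nonpos)
  moreover have "even (j * (j + 1))" by simp
  ultimately show ?thesis by (simp add: tri_def)
qed

lemma tri_rec: "int (tri j) = int (tri (j - 1)) + j"
  using int_tri[of j] int_tri[of "j - 1"] by (simp add: algebra_simps)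

text \<open>The triple product is stated in Ramanujan's form
  \<open>\<Sum>j. a ^ (j (j + 1) / 2) * b ^ (j (j - 1) / 2)\<close> with base \<open>p = a * b\<close>, because
  it needs no negative powers and so makes sense in any commutative ring.\<close>

definition theta_term :: "'a::comm_ring_1 \<Rightarrow> 'a \<Rightarrow> int \<Rightarrow> 'a" where
  "theta_term a b j = a ^ tri j * b ^ tri (j - 1)"

text \<open>Formally the ratio of the terms at \<open>j\<close> and \<open>j - 1\<close> is a
  (ab)^(j-1). Comparing the exponents of \<open>a\<close> and of \<open>b\<close> separately avoids
  negative powers.\<close>

lemma theta_term_up:
  assumes "int d = int m + 1 - j"
  shows "a * (a * b) ^ m * theta_term a b (j - 1) = (a * b) ^ d * theta_term a b j"
proof -
  have "Suc (m + tri (j - 1)) = d + tri j" and "m + tri (j - 1 - 1) = d + tri (j - 1)"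
    using assms tri_rec[of j] tri_rec[of "j - 1"] by linarith+
  then have "a ^ Suc (m + tri (j - 1)) * b ^ (m + tri (j - 1 - 1))
      = a ^ (d + tri j) * b ^ (d + tri (j - 1))"
    by simp
  then show ?thesis
    unfolding theta_term_def by (simp add: power_mult_distrib power_add ac_simps)
qed

lemma theta_term_down:
  assumes "int d = int n + j"
  shows "b * (a * b) ^ n * theta_term a b j = (a * b) ^ d * theta_term a b (j - 1)"
proof -
  have "n + tri j = d + tri (j - 1)" and "Suc (n + tri (j - 1)) = d + tri (j - 1 - 1)"
    using assms tri_rec[of j] tri_rec[of "j - 1"] by linarith+
  then have "a ^ (n + tri j) * b ^ Suc (n + tri (j - 1))
      = a ^ (d + tri (j - 1)) * b ^ (d + tri (j - 1 - 1))"
    by simp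
  then show ?thesis
    unfolding theta_term_def by (simp add: power_mult_distrib power_add ac_simps)
qed

text \<open>Build up the \<open>b\<close>-factors first, with \<open>m = 0\<close>, then the
  \<open>a\<close>-factors. A new factor in \<open>b\<close> matches the defining Pascal rule, a new
  factor in \<open>a\<close> the mirrored one; in both cases the extra power of \<open>p\<close>
  turns a shifted theta term into the old one.\<close>

lemma finite_triple_product:
  fixes a b :: "'a::comm_ring_1"
  defines "p \<equiv> a * b"
  shows "(\<Prod>k<m. 1 + a * p ^ k) * (\<Prod>k<n. 1 + b * p ^ k)
       = (\<Sum>i\<le>m + n. qbinomial p (m + n) i * theta_term a b (int i - int n))"
proof (induction m)
  case 0
  show ?case
  proof (induction n)
    case 0
    show ?case by (simp add: theta_term_def tri_def)
  next
    case (Suc n)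
    let ?t = "theta_term a b" and ?q = "qbinomial p"
    have t: "?t (int (Suc i) - int (Suc n)) = ?t (int i - int n)" for i
      by simp
    have d: "b * p ^ n * ?t (int i - int n) = p ^ i * ?t (int i - int (Suc n))" for i
      using theta_term_down[of i n "int i - int n" b a] by (simp add: p_def algebra_simps)
    have "(\<Sum>i\<le>Suc n. ?q (Suc n) i * ?t (int i - int (Suc n)))
        = ?t (- int (Suc n)) + (\<Sum>i\<le>n. (?q n i + p ^ Suc i * ?q n (Suc i)) * ?t (int i - int n))"
      by (subst sum.atMost_Suc_shift) (simp add: t)
    also have "\<dots> = (\<Sum>i\<le>n. ?q n i * ?t (int i - int n))
          + (?t (- int (Suc n)) + (\<Sum>i\<le>n. p ^ Suc i * ?q n (Suc i) * ?t (int i - int n)))"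
      by (simp add: ring_distribs sum.distrib)
    \<comment> \<open>The separated term is the missing summand \<open>i = 0\<close> of the shifted
      sum; the summand \<open>i = Suc n\<close> then vanishes.\<close>
    also have "?t (- int (Suc n)) + (\<Sum>i\<le>n. p ^ Suc i * ?q n (Suc i) * ?t (int i - int n))
        = (\<Sum>i\<le>Suc n. p ^ i * ?q n i * ?t (int i - int (Suc n)))"
      by (subst sum.atMost_Suc_shift) (simp add: t)
    also have "\<dots> = (\<Sum>i\<le>n. ?q n i * (p ^ i * ?t (int i - int (Suc n))))"
      by (simp add: qbinomial_eq_0 ac_simps)
    also have "\<dots> = b * p ^ n * (\<Sum>i\<le>n. ?q n i * ?t (int i - int n))"
      unfolding d[symmetric] by (simp add: sum_distrib_left ac_simps)
    finally show ?case
      using Suc.IH by (simp add: algebra_simps)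
  qed
next
  case (Suc m)
  let ?t = "theta_term a b" and ?q = "qbinomial p" and ?M = "m + n"
  have d: "p ^ (?M - i) * ?t (int (Suc i) - int n) = a * p ^ m * ?t (int i - int n)"
    if "i \<le> ?M" for i
    using theta_term_up[of "?M - i" m "int (Suc i) - int n" a b] that
    by (simp add: p_def algebra_simps of_nat_diff)
  \<comment> \<open>The mirrored rule is the right one here: its power \<open>p ^ (?M - i)\<close>
    is what the shift \<open>d\<close> consumes.\<close>
  have "(\<Sum>i\<le>Suc ?M. ?q (Suc ?M) i * ?t (int i - int n))
      = ?t (- int n) + (\<Sum>i\<le>?M. (p ^ (?M - i) * ?q ?M i + ?q ?M (Suc i)) * ?t (int (Suc i) - int n))"
    by (subst sum.atMost_Suc_shift) (simp add: qbinomial_Suc_Suc' del: qbinomial.simps(3))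
  also have "\<dots> = (\<Sum>i\<le>?M. ?q ?M i * (p ^ (?M - i) * ?t (int (Suc i) - int n)))
      + (?t (- int n) + (\<Sum>i\<le>?M. ?q ?M (Suc i) * ?t (int (Suc i) - int n)))"
    by (simp add: ring_distribs sum.distrib ac_simps)
  also have "?t (- int n) + (\<Sum>i\<le>?M. ?q ?M (Suc i) * ?t (int (Suc i) - int n))
      = (\<Sum>i\<le>Suc ?M. ?q ?M i * ?t (int i - int n))"
    by (subst sum.atMost_Suc_shift) simp
  also have "\<dots> = (\<Sum>i\<le>?M. ?q ?M i * ?t (int i - int n))"
    by (simp add: qbinomial_eq_0)
  also have "(\<Sum>i\<le>?M. ?q ?M i * (p ^ (?M - i) * ?t (int (Suc i) - int n)))
      = a * p ^ m * (\<Sum>i\<le>?M. ?q ?M i * ?t (int i - int n))"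
    unfolding sum_distrib_left
  proof (rule sum.cong)
    fix i assume "i \<in> {..?M}"
    then show "?q ?M i * (p ^ (?M - i) * ?t (int (Suc i) - int n)) = a * p ^ m * (?q ?M i * ?t (int i - int n))"
      by (subst d) (simp_all add: ac_simps)
  qed simp
  finally show ?case
    using Suc.IH by (simp add: algebra_simps)
qed

section \<open>Congruence of power series modulo a power of the variable\<close>

text \<open>Replaces infinite products: only finite ones occur, modulo a power of the variable.\<close>

definition fps_cong :: "nat \<Rightarrow> 'a::comm_ring_1 fps \<Rightarrow> 'a fps \<Rightarrow> bool" where
  "fps_cong N f g \<longleftrightarrow> (\<forall>i<N. f $ i = g $ i)"

lemma fps_cong_refl [simp]: "fps_cong N f f"
  by (simp add: fps_cong_def)

lemma fps_cong_sym: "fps_cong N f g \<Longrightarrow> fps_cong N g f"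
  by (simp add: fps_cong_def)

lemma fps_cong_trans [trans]: "fps_cong N f g \<Longrightarrow> fps_cong N g h \<Longrightarrow> fps_cong N f h"
  by (simp add: fps_cong_def)

lemma fps_cong_eq_trans [trans]: "f = g \<Longrightarrow> fps_cong N g h \<Longrightarrow> fps_cong N f h"
  by simp

lemma fps_cong_trans_eq [trans]: "fps_cong N f g \<Longrightarrow> g = h \<Longrightarrow> fps_cong N f h"
  by simp

lemma fps_cong_mult:
  "fps_cong N f f' \<Longrightarrow> fps_cong N g g' \<Longrightarrow> fps_cong N (f * g) (f' * g')"
  unfolding fps_cong_def fps_mult_nth by (intro allI impI sum.cong) auto

lemma fps_cong_sum:
  "(\<And>k. k \<in> A \<Longrightarrow> fps_cong N (f k) (g k)) \<Longrightarrow> fps_cong N (sum f A) (sum g A)"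
  unfolding fps_cong_def by (simp add: fps_sum_nth)

lemma fps_cong_prod_1:
  "(\<And>k. k \<in> A \<Longrightarrow> fps_cong N (f k) 1) \<Longrightarrow> fps_cong N (prod f A) 1"
proof (induction A rule: infinite_finite_induct)
  case (insert x A)
  then show ?case using fps_cong_mult[of N "f x" 1 "prod f A" 1] by simp
qed auto

text \<open>A series with nonzero constant term over a field is a unit.\<close>

lemma fps_cong_cancel:
  fixes f g h :: "'a::field fps"
  assumes "fps_cong N (h * f) (h * g)" "h $ 0 \<noteq> 0"
  shows "fps_cong N f g"
proof -
  have "fps_cong N (inverse h * (h * f)) (inverse h * (h * g))"
    by (intro fps_cong_mult assms) simp
  then show ?thesis
    using assms(2) by (simp add: mult.assoc[symmetric] inverse_mult_eq_1)
qed

lemma fps_cong_power_eq_0: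
  assumes "N \<le> k"
  shows "fps_cong N (f * fps_X ^ k) 0"
  using assms by (simp add: fps_cong_def fps_X_power_mult_right_nth)

lemma fps_cong_1_plus:
  assumes "N \<le> k"
  shows "fps_cong N (1 + f * fps_X ^ k) 1"
  using assms by (simp add: fps_cong_def fps_X_power_mult_right_nth)

lemma prod_fps_nth_0: "(prod f A :: 'a::comm_ring_1 fps) $ 0 = (\<Prod>k\<in>A. f k $ 0)"
  by (induction A rule: infinite_finite_induct) auto

lemma qfact_nth_0: "r > 0 \<Longrightarrow> qfact (fps_X ^ r :: 'a::comm_ring_1 fps) n $ 0 = 1"
  by (simp add: qfact_def prod_fps_nth_0 power_mult[symmetric] del: power_Suc mult_Suc_right)

lemma fps_cong_prod_extend:
  fixes f :: "nat \<Rightarrow> 'a::comm_ring_1 fps"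
  assumes "n \<le> m" "\<And>k. n \<le> k \<Longrightarrow> fps_cong N (f k) 1"
  shows "fps_cong N (\<Prod>k<m. f k) (\<Prod>k<n. f k)"
proof -
  have "(\<Prod>k<m. f k) = (\<Prod>k<n. f k) * (\<Prod>k=n..<m. f k)"
    using assms(1) by (subst prod.union_disjoint[symmetric]) (auto intro!: prod.cong)
  moreover have "fps_cong N ((\<Prod>k<n. f k) * (\<Prod>k=n..<m. f k)) ((\<Prod>k<n. f k) * 1)"
    by (intro fps_cong_mult fps_cong_prod_1 fps_cong_refl) (use assms(2) in auto)
  ultimately show ?thesis by simp
qed

text \<open>Factors with index at least \<open>N\<close> are 1 modulo X^N, so both products reduce
  to the one of length \<open>N\<close>.\<close>

lemma fps_cong_qfact:
  assumes "r > 0" "N \<le> n" "N \<le> m"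
  shows "fps_cong N (qfact (fps_X ^ r :: 'a::comm_ring_1 fps) m) (qfact (fps_X ^ r) n)"
proof -
  have "fps_cong N (qfact (fps_X ^ r :: 'a fps) m) (qfact (fps_X ^ r) N)" if "N \<le> m" for m
    unfolding qfact_def
  proof (rule fps_cong_prod_extend[OF that])
    fix k assume "N \<le> k"
    then have "N \<le> r * Suc k"
      using assms(1) by (metis One_nat_def Suc_leI le_SucI le_trans mult_le_mono1 nat_mult_1)
    then show "fps_cong N (1 - (fps_X ^ r :: 'a fps) ^ Suc k) 1"
      using fps_cong_1_plus[of N "r * Suc k" "-1 :: 'a fps"] by (simp add: power_mult del: power_Suc mult_Suc_right)
  qed
  from this[OF assms(3)] this[OF assms(2)] show ?thesis
    by (blast intro: fps_cong_trans fps_cong_sym)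
qed

text \<open>The truncated form of the limit of the Gaussian binomial being 1/(p;p). In the quotient
  formula the three Pochhammer products are long enough to be congruent to \<open>qfact p n\<close>,
  which is a unit.\<close>

lemma fps_cong_qfact_qbinomial:
  fixes r :: nat
  defines "p \<equiv> fps_X ^ r :: 'a::field fps"
  assumes r: "r > 0" and "N \<le> k" "k + N \<le> m" "N \<le> n"
  shows "fps_cong N (qfact p n * qbinomial p m k) 1"
proof (rule fps_cong_cancel[where h = "qfact p n"])
  have "fps_cong N (qfact p n * qfact p n * qbinomial p m k)
          (qfact p k * qfact p (m - k) * qbinomial p m k)"
    unfolding p_def by (intro fps_cong_mult fps_cong_qfact fps_cong_refl) (use assms in auto)
  also have "\<dots> = qfact p m"
    by (rule qbinomial_qfact) (use assms in auto)
  also have "fps_cong N (qfact p m) (qfact p n)"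
    unfolding p_def by (intro fps_cong_qfact) (use assms in auto)
  finally show "fps_cong N (qfact p n * (qfact p n * qbinomial p m k)) (qfact p n * 1)"
    by (simp add: mult.assoc)
  show "qfact p n $ 0 \<noteq> 0" by (simp add: p_def qfact_nth_0 r)
qed

section \<open>Jacobi's triple product for power series\<close>

text \<open>The constants \<open>c\<close> and \<open>inverse c\<close> cancel in the base, and in
  the terms they leave the power \<open>j\<close>, because \<open>tri j\<close> and
  \<open>tri (j - 1)\<close> differ by \<open>j\<close>.\<close>

lemma theta_term_monom:
  fixes c :: "'a::field"
  assumes "c \<noteq> 0"
  shows "theta_term (fps_const c * fps_X ^ u) (fps_const (inverse c) * fps_X ^ v) j
    = fps_const (c powi j) * fps_X ^ (u * tri j + v * tri (j - 1))"
proof -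
  have "c ^ tri j * inverse c ^ tri (j - 1) = c powi (int (tri j) - int (tri (j - 1)))"
    using assms by (simp add: power_int_diff power_inverse divide_inverse)
  then have "c ^ tri j * inverse c ^ tri (j - 1) = c powi j"
    using tri_rec[of j] by simp
  moreover have "theta_term (fps_const c * fps_X ^ u) (fps_const (inverse c) * fps_X ^ v) j
     = (fps_const (c ^ tri j) * fps_const (inverse c ^ tri (j - 1)))
       * (fps_X ^ (u * tri j) * fps_X ^ (v * tri (j - 1)))"
    unfolding theta_term_def power_mult_distrib fps_const_power power_mult by (simp only: ac_simps)
  ultimately show ?thesis by (simp add: power_add)
qed

lemma abs_le_tri: "\<bar>j\<bar> \<le> int (tri j) + 1" "\<bar>j\<bar> \<le> int (tri (j - 1)) + 1"
proof -
  \<comment> \<open>A product of two consecutive integers is never negative.\<close>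
  have "0 \<le> (\<bar>j\<bar> - 1) * (\<bar>j\<bar> - 2)"
    by (cases "\<bar>j\<bar> \<le> 1") (auto intro: mult_nonneg_nonneg mult_nonpos_nonpos)
  then have *: "0 \<le> j * j - 3 * \<bar>j\<bar> + 2"
    by (simp add: algebra_simps)
  show "\<bar>j\<bar> \<le> int (tri j) + 1"
    using * int_tri[of j] by (simp add: algebra_simps)
  show "\<bar>j\<bar> \<le> int (tri (j - 1)) + 1"
    using * int_tri[of "j - 1"] by (simp add: algebra_simps)
qed

text \<open>Multiply the finite identity with \<open>m = n\<close> by \<open>qfact p n\<close>. In
  the middle range of \<open>i\<close> the coefficient becomes 1 modulo X^N; outside it the theta
  term itself vanishes modulo X^N.\<close>

theorem triple_product_fps:
  fixes c :: "'a::field"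
  assumes c: "c \<noteq> 0" and r: "u + v > 0" and n: "2 * N + 1 \<le> n"
  shows "fps_cong N
     ((\<Prod>k<n. 1 - fps_X ^ ((u + v) * Suc k))
       * (\<Prod>k<n. 1 + fps_const c * fps_X ^ (u + (u + v) * k))
       * (\<Prod>k<n. 1 + fps_const (inverse c) * fps_X ^ (v + (u + v) * k)))
     (\<Sum>j\<in>{-int n..int n}. fps_const (c powi j) * fps_X ^ (u * tri j + v * tri (j - 1)))"
    (is "fps_cong N ?L (\<Sum>j\<in>_. ?t j)")
proof -
  let ?a = "fps_const c * fps_X ^ u" and ?b = "fps_const (inverse c) * fps_X ^ v"
  define p :: "'a fps" where "p = fps_X ^ (u + v)"
  have ab: "?a * ?b = p"
  proof -
    have "?a * ?b = (fps_const c * fps_const (inverse c)) * (fps_X ^ u * fps_X ^ v)"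
      by (simp only: ac_simps)
    then show ?thesis using c by (simp add: p_def power_add)
  qed
  have "fps_X ^ ((u + v) * Suc k) = p ^ Suc k"
    and "fps_const c * fps_X ^ (u + (u + v) * k) = ?a * p ^ k"
    and "fps_const (inverse c) * fps_X ^ (v + (u + v) * k) = ?b * p ^ k" for k
    by (simp_all only: p_def power_mult power_add[of _ u "(u + v) * k"] power_add[of _ v "(u + v) * k"] mult.assoc)
  then have "?L = qfact p n * ((\<Prod>k<n. 1 + ?a * p ^ k) * (\<Prod>k<n. 1 + ?b * p ^ k))"
    by (simp only: qfact_def mult.assoc)
  also have "\<dots> = (\<Sum>i\<le>n + n. qfact p n * qbinomial p (n + n) i * ?t (int i - int n))"
    using finite_triple_product[of ?a ?b n n, unfolded ab theta_term_monom[OF c]]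
    by (simp only: sum_distrib_left mult.assoc)
  also have "fps_cong N \<dots> (\<Sum>i\<le>n + n. ?t (int i - int n))"
  proof (rule fps_cong_sum)
    fix i assume i: "i \<in> {..n + n}"
    show "fps_cong N (qfact p n * qbinomial p (n + n) i * ?t (int i - int n)) (?t (int i - int n))"
    proof (cases "N \<le> i \<and> i + N \<le> n + n")
      case True
      then have "fps_cong N (qfact p n * qbinomial p (n + n) i) 1"
        unfolding p_def using r n by (intro fps_cong_qfact_qbinomial) auto
      from fps_cong_mult[OF this fps_cong_refl] show ?thesis by simp
    next
      case False
      define j where "j = int i - int n"
      \<comment> \<open>Outside the middle range \<bar>j\<bar> exceeds n - N, which is at least N +
        1 by the choice of \<open>n\<close>.\<close>
      have "int N + 1 \<le> \<bar>j\<bar>" using False n i by (auto simp: j_def)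
      then have "N \<le> tri j" "N \<le> tri (j - 1)" using abs_le_tri[of j] by linarith+
      \<comment> \<open>One of \<open>u\<close> and \<open>v\<close> may be 0, so either bound alone
        would not suffice.\<close>
      then have "N \<le> u * tri j + v * tri (j - 1)"
        using r by (cases u; cases v) (auto intro: trans_le_add1)
      then have z: "fps_cong N (f * ?t j) 0" for f
        using fps_cong_power_eq_0[of N _ "f * fps_const (c powi j)"] by (simp add: mult.assoc)
      from fps_cong_trans[OF z fps_cong_sym[OF z[of 1]]] show ?thesis
        unfolding j_def by simp
    qed
  qed
  also have "(\<Sum>i\<le>n + n. ?t (int i - int n)) = (\<Sum>j\<in>{-int n..int n}. ?t j)"
    by (rule sum.reindex_bij_witness[of _ "\<lambda>j. nat (j + int n)" "\<lambda>i. int i - int n"]) auto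
  finally show ?thesis .
qed


section \<open>The pentagonal number theorem and Euler's identity\<close>

lemma prod_lessThan_double:
  fixes n :: nat
  shows
  "(\<Prod>k<2 * n. f k) = (\<Prod>k<n. f (2 * k)) * (\<Prod>k<n. f (2 * k + 1) :: 'a::comm_monoid_mult)"
  by (induction n) (simp_all add: ac_simps)

lemma prod_lessThan_triple:
  fixes n :: nat
  shows
  "(\<Prod>k<3 * n. f k)
    = (\<Prod>k<n. f (3 * k)) * (\<Prod>k<n. f (3 * k + 1)) * (\<Prod>k<n. f (3 * k + 2) :: 'a::comm_monoid_mult)"
  by (induction n) (simp_all add: ac_simps eval_nat_numeral)

text \<open>The triple product with \<open>c = -1\<close>, \<open>u = r\<close>,
  \<open>v = 2 * r\<close>: its three products are the residue classes modulo 3 of the exponents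
  divided by \<open>r\<close>.\<close>

lemma pentagonal_fps:
  assumes "r > 0" "2 * N + 1 \<le> n"
  shows "fps_cong N (\<Prod>k<3 * n. 1 - fps_X ^ (r * Suc k) :: 'a::field fps)
     (\<Sum>j\<in>{-int n..int n}. fps_const ((-1) powi j) * fps_X ^ (r * (tri j + 2 * tri (j - 1))))"
proof -
  have neg: "fps_const (-1 :: 'a) = -1"
    by (simp flip: fps_const_neg)
  have "(\<Prod>k<3 * n. 1 - fps_X ^ (r * Suc k) :: 'a fps)
      = (\<Prod>k<n. 1 - fps_X ^ ((r + 2 * r) * Suc k))
       * (\<Prod>k<n. 1 + fps_const (-1) * fps_X ^ (r + (r + 2 * r) * k))
       * (\<Prod>k<n. 1 + fps_const (inverse (-1)) * fps_X ^ (2 * r + (r + 2 * r) * k))"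
    unfolding prod_lessThan_triple by (simp add: neg algebra_simps)
  then show ?thesis
    using triple_product_fps[of "-1 :: 'a" r "2 * r" N n] assms by (simp add: algebra_simps)
qed

text \<open>Multiply by (q;q)_n with q = X^r. Its product with the second factor consists of the
  even-indexed factors of (q;q)_2n, the first factor supplies the odd ones, and (q;q)_2n is
  congruent to (q;q)_n, which cancels.\<close>

lemma euler_odd_distinct:
  assumes r: "r > 0" and n: "N \<le> n"
  shows "fps_cong N
    ((\<Prod>k<n. 1 - fps_X ^ (r * (2 * k + 1))) * (\<Prod>k<n. 1 + fps_X ^ (r * Suc k))) (1 :: 'a::field fps)"
    (is "fps_cong N (?O * ?D) 1")
proof (rule fps_cong_cancel)
  let ?P = "qfact (fps_X ^ r) :: nat \<Rightarrow> 'a fps"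
  have P: "?P m = (\<Prod>k<m. 1 - fps_X ^ (r * Suc k))" for m
    unfolding qfact_def power_mult ..
  have "?P n * ?D = (\<Prod>k<n. 1 - fps_X ^ (r * Suc (2 * k + 1)))"
    unfolding P prod.distrib[symmetric]
    by (intro prod.cong) (simp_all add: algebra_simps mult_2 flip: power_add)
  then have "?P n * (?O * ?D) = ?P (2 * n)"
    unfolding P prod_lessThan_double by (simp add: ac_simps)
  also have "fps_cong N \<dots> (?P n * 1)"
    using fps_cong_qfact[OF r, of N n "2 * n"] n by simp
  finally show "fps_cong N (?P n * (?O * ?D)) (?P n * 1)" .
  show "?P n $ 0 \<noteq> 0" by (simp add: qfact_nth_0 r)
qed

section \<open>The generating function of \<open>Q2\<close>\<close>

text \<open>The parts allowed are the odd numbers and the multiples of 6. The two lengths are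
  independent because splitting the odd factors modulo 3 needs three times as many of them.\<close>

definition Q2_prod :: "nat \<Rightarrow> nat \<Rightarrow> complex fps" where
  "Q2_prod K L = (\<Prod>k<K. 1 + fps_X ^ (2 * k + 1)) * (\<Prod>k<L. 1 + fps_X ^ (6 * Suc k))"

text \<open>Expanding the product gives one monomial per subset of \<open>T\<close>. The truncation
  does no harm, since the parts of a partition of \<open>m\<close> are at most
  \<open>m\<close>.\<close>

lemma Q2_prod_nth:
  assumes "m < K" "m < L"
  shows "Q2_prod K L $ m = of_nat (Q2 (int m))"
proof -
  let ?S = "(\<lambda>k. 2 * k + 1) ` {..<K}" and ?S' = "(\<lambda>k. 6 * Suc k) ` {..<L}"
  define T where "T = ?S \<union> ?S'"
  have "odd a" if "a \<in> ?S" for a using that by auto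
  moreover have "even a" if "a \<in> ?S'" for a using that by auto
  ultimately have disj: "?S \<inter> ?S' = {}" by blast
  have fin: "finite T" by (simp add: T_def)
  have "Q2_prod K L = (\<Prod>a\<in>?S. 1 + fps_X ^ a) * (\<Prod>a\<in>?S'. 1 + fps_X ^ a)"
    by (simp add: Q2_prod_def prod.reindex inj_on_def)
  also have "\<dots> = (\<Prod>a\<in>T. fps_X ^ a + 1)"
    unfolding T_def using disj by (subst prod.union_disjoint) (simp_all add: add.commute)
  also have "\<dots> = (\<Sum>A\<in>Pow T. fps_X ^ \<Sum>A)"
    by (subst prod_add[OF fin]) (simp add: power_sum)
  finally have "Q2_prod K L $ m = (\<Sum>A\<in>Pow T. if m = \<Sum>A then 1 else 0)"
    by (simp add: fps_sum_nth fps_X_power_nth)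
  also have "\<dots> = of_nat (card {A\<in>Pow T. \<Sum>A = m})"
    using fin by (subst sum.inter_filter[symmetric]) (simp_all add: eq_commute)
  also have "{A\<in>Pow T. \<Sum>A = m} = {A. finite A \<and>
     (\<forall>a\<in>A. a > 0 \<and> \<not> [int a = 2] (mod 6) \<and> \<not> [int a = -2] (mod 6)) \<and> int (\<Sum>A) = int m}"
    (is "?L = ?R")
  proof (intro equalityI subsetI)
    fix A assume A: "A \<in> ?L"
    have "a > 0 \<and> \<not> [int a = 2] (mod 6) \<and> \<not> [int a = -2] (mod 6)" if "a \<in> T" for a
      using that unfolding T_def cong_def by (elim UnE imageE) (simp; presburger)+
    then show "A \<in> ?R" using A fin by (auto dest: finite_subset)
  next
    fix A assume A: "A \<in> ?R"
    have "a \<in> T" if a: "a \<in> A" for a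
    proof -
      have "a \<le> m" using A a member_le_sum[of a A "\<lambda>x. x"] by (auto simp del: of_nat_sum)
      moreover have "a > 0" "\<not> [int a = 2] (mod 6)" "\<not> [int a = -2] (mod 6)" using A a by auto
      then have "int a mod 6 \<noteq> 2" "int a mod 6 \<noteq> 4" by (simp_all add: cong_def)
      then have "odd (int a) \<or> int 6 dvd int a" by presburger
      then have "odd a \<or> 6 dvd a" by (simp only: even_of_nat int_dvd_int_iff)
      ultimately show ?thesis
        using \<open>a > 0\<close> assms
      proof (elim disjE)
        assume "odd a"
        then obtain k where "a = 2 * k + 1" by (rule oddE)
        then show ?thesis using \<open>a \<le> m\<close> assms by (auto simp: T_def)
      next
        assume "6 dvd a"
        then obtain l where "a = 6 * l" ..
        then obtain k where "a = 6 * Suc k" using \<open>a > 0\<close> by (cases l) auto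
        then show ?thesis using \<open>a \<le> m\<close> assms by (auto simp: T_def)
      qed
    qed
    then show "A \<in> ?L" using A by (auto simp del: of_nat_sum)
  qed
  finally show ?thesis by (simp add: Q2_def)
qed

lemma Q2_neg: "n < 0 \<Longrightarrow> Q2 n = 0"
  unfolding Q2_def by (subst card_eq_0_iff) (auto simp del: of_nat_sum)

lemma int_pentagonal: "int (tri j + 2 * tri (j - 1)) = j * (3 * j - 1) div 2"
  using int_tri[of j] int_tri[of "j - 1"] by (simp add: algebra_simps)

text \<open>The common last step, used with \<open>r = 1\<close> and \<open>r = 3\<close>: once the
  product is known to be a series \<open>R\<close>, comparing coefficients at \<open>n\<close>
  evaluates the sum over \<open>j\<close>, which has only finitely many nonzero terms.\<close>

lemma pentagonal_Q2_has_sum: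
  assumes r: "r > 0" and n: "n < N" "N \<le> K" "N \<le> L" "2 * N + 1 \<le> M"
    and cong: "fps_cong N ((\<Prod>k<3 * M. 1 - fps_X ^ (r * Suc k)) * Q2_prod K L) R"
    and c: "R $ n = of_real c"
  shows "((\<lambda>j. (-1) powi j * real (Q2 (int n - int r * (j * (3 * j - 1) div 2)))) has_sum c) UNIV"
proof (rule has_sum_finite_neutralI)
  define e where "e j = r * (tri j + 2 * tri (j - 1))" for j
  have int_e: "int (e j) = int r * (j * (3 * j - 1) div 2)" for j
    unfolding e_def of_nat_mult int_pentagonal ..
  let ?f = "\<lambda>j. (-1) powi j * real (Q2 (int n - int r * (j * (3 * j - 1) div 2)))"
  have "fps_cong N (\<Sum>j\<in>{-int M..int M}. fps_const ((-1) powi j) * fps_X ^ e j :: complex fps)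
      (\<Prod>k<3 * M. 1 - fps_X ^ (r * Suc k))"
    unfolding e_def using pentagonal_fps[OF r n(4)] by (rule fps_cong_sym)
  then have "fps_cong N ((\<Sum>j\<in>{-int M..int M}. fps_const ((-1) powi j) * fps_X ^ e j) * Q2_prod K L) R"
    by (rule fps_cong_trans[OF fps_cong_mult[OF _ fps_cong_refl] cong])
  then have "R $ n = ((\<Sum>j\<in>{-int M..int M}. fps_const ((-1) powi j) * fps_X ^ e j) * Q2_prod K L) $ n"
    using n by (simp add: fps_cong_def)
  also have "\<dots> = (\<Sum>j\<in>{-int M..int M}. (fps_const ((-1) powi j) * (fps_X ^ e j * Q2_prod K L)) $ n)"
    by (simp add: sum_distrib_right fps_sum_nth mult.assoc)
  also have "\<dots> = (\<Sum>j\<in>{-int M..int M}. of_real (?f j))"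
  proof (intro sum.cong refl)
    fix j
    show "(fps_const ((-1) powi j) * (fps_X ^ e j * Q2_prod K L)) $ n = of_real (?f j)"
    \<comment> \<open>If the monomial exceeds degree \<open>n\<close>, the coefficient is 0 and so
      is \<open>Q2\<close> at the negative argument.\<close>
    proof (cases "n < e j")
      case True
      then show ?thesis by (simp add: fps_X_power_mult_nth Q2_neg flip: int_e)
    next
      case False
      then have "Q2_prod K L $ (n - e j) = of_nat (Q2 (int n - int (e j)))"
        using n by (subst Q2_prod_nth) (auto simp: of_nat_diff)
      then show ?thesis using False by (simp add: fps_X_power_mult_nth int_e)
    qed
  qed
  finally show "c = (\<Sum>j\<in>{-int M..int M}. ?f j)"
    using c by (simp only: of_real_eq_iff of_real_sum[symmetric])
  fix j assume "j \<in> UNIV - {-int M..int M}"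
  then have "int n < int (tri j)" using abs_le_tri[of j] n by auto
  also have "\<dots> \<le> int (e j)" using r by (cases r) (auto simp: e_def)
  finally show "?f j = 0" by (simp add: Q2_neg flip: int_e)
qed simp_all

lemma fps_sum_monom_nth:
  assumes "finite A"
  shows "(\<Sum>j\<in>A. fps_const (c j) * fps_X ^ e j) $ n = (\<Sum>j\<in>{j\<in>A. e j = n}. c j :: 'a::comm_ring_1)"
  using assms by (simp add: sum.inter_filter fps_sum_nth fps_X_power_nth eq_commute[of n]
      if_distrib[of "(*) _"] cong: if_cong)

section \<open>Part (i): cube roots of unity\<close>

lemma primitive_cube_root:
  obtains w :: complex where "1 + w + w ^ 2 = 0"
proof
  show "1 + Complex (-1/2) (sqrt 3 / 2) + (Complex (-1/2) (sqrt 3 / 2)) ^ 2 = 0"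
    by (simp add: complex_eq_iff power2_eq_square)
qed

context
  fixes w :: complex
  assumes w: "1 + w + w ^ 2 = 0"
begin

lemma cube_root_facts: "w \<noteq> 0" "w ^ 3 = 1" "inverse w = w ^ 2" "1 + inverse w = - w"
proof -
  show "w \<noteq> 0" using w by auto
  have "w ^ 3 - 1 = (w - 1) * (1 + w + w ^ 2)" by algebra
  then show "w ^ 3 = 1" using w by simp
  then have "w * w ^ 2 = 1" by (simp add: eval_nat_numeral)
  then show i: "inverse w = w ^ 2" by (rule inverse_unique)
  show "1 + inverse w = - w" using w by (simp add: i algebra_simps eq_neg_iff_add_eq_0)
qed

text \<open>Since w^3 = 1, the left side is w^k + w^(2k+2) and depends only on \<open>k\<close>
  modulo 3. The three values are 1 + w^2 = -w, w + w^4 = 2w and w^2 + w^6 = -w.\<close>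

lemma cube_root_rho:
  "w ^ k + w powi (- int k - 1) = - w * of_int (rho (int k))"
proof -
  have "- int k - 1 = - int (Suc k)" by simp
  then have "w powi (- int k - 1) = w powi - int (Suc k)" by (simp only:)
  also have "\<dots> = inverse w ^ Suc k" unfolding power_int_minus power_int_of_nat by (simp add: power_inverse)
  also have "\<dots> = w ^ (2 * Suc k)" by (simp only: cube_root_facts power_mult)
  finally have *: "w ^ k + w powi (- int k - 1) = w ^ k + w ^ (2 * Suc k)" by simp
  have p: "w ^ (3 * l + s) = w ^ s" for l s
    by (simp add: power_add power_mult cube_root_facts)
  define l s where "l = k div 3" and "s = k mod 3"
  have k: "k = 3 * l + s" by (simp add: l_def s_def)
  then have "2 * Suc k = 3 * (2 * l) + 2 * Suc s" by simp
  with k have red: "w ^ k = w ^ s" "w ^ (2 * Suc k) = w ^ (2 * Suc s)" by (metis p)+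
  have w2: "w ^ 2 = - w - 1" using w by algebra
  have "s < 3" by (simp add: s_def)
  then consider "s = 0" | "s = 1" | "s = 2" by linarith
  then have "w ^ s + w ^ (2 * Suc s) = - w * of_int (rho (int k))"
  proof cases
    case 1
    then have "rho (int k) = 1" unfolding rho_def cong_def k by simp
    then show ?thesis using 1 w2 by simp
  next
    case 2
    then have "rho (int k) = -2" unfolding rho_def cong_def k by simp
    moreover have "w ^ 4 = w" using p[of 1 1] by simp
    ultimately show ?thesis using 2 by simp
  next
    case 3
    then have "rho (int k) = 1" unfolding rho_def cong_def k by simp
    moreover have "w ^ 6 = 1" using p[of 2 0] by simp
    ultimately show ?thesis using 3 w2 by simp
  qed
  then show ?thesis by (simp only: *[unfolded red] red)
qed

lemma cube_root_triple_product:
  assumes n: "2 * N + 1 \<le> n"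
  shows "fps_cong N ((\<Prod>k<2 * n. 1 - fps_X ^ Suc k) * Q2_prod n n)
    (fps_const (inverse (- w)) * (\<Sum>j\<in>{-int n..int n}. fps_const (w powi j) * fps_X ^ (2 * tri j)))"
proof -
  \<comment> \<open>With q the variable, \<open>Om * P\<close> is (q;q), and
    \<open>Op * D * C\<close> is the generating function of \<open>Q2\<close>.\<close>
  define P D C :: "complex fps" where
    "P = (\<Prod>k<n. 1 - fps_X ^ (2 * Suc k))" and
    "D = (\<Prod>k<n. 1 + fps_X ^ (2 * Suc k))" and
    "C = (\<Prod>k<n. 1 - fps_X ^ (2 * Suc k) + fps_X ^ (4 * Suc k))"
  define B B' :: "complex fps" where
    "B = (\<Prod>k<n. 1 + fps_const (inverse w) * fps_X ^ (2 * Suc k))" and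
    "B' = (\<Prod>k<n. 1 + fps_const (inverse w) * fps_X ^ (2 * k))"
  define Om Op :: "complex fps" where
    "Om = (\<Prod>k<n. 1 - fps_X ^ (2 * k + 1))" and "Op = (\<Prod>k<n. 1 + fps_X ^ (2 * k + 1))"
  define A :: "complex fps" where "A = (\<Prod>k<n. 1 + fps_const w * fps_X ^ (2 * Suc k))"
  obtain m where m: "n = Suc m" using n by (cases n) auto
  \<comment> \<open>\<open>B'\<close> starts at exponent 0, and that first factor is 1 + 1/w =
    -w.\<close>
  have "B' = fps_const (- w) * (\<Prod>k<m. 1 + fps_const (inverse w) * fps_X ^ (2 * Suc k))"
    unfolding B'_def m by (subst prod.lessThan_Suc_shift)
      (simp add: fps_const_add[symmetric] cube_root_facts(4)[symmetric] del: fps_const_add)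
  \<comment> \<open>\<open>B\<close> has one factor more, whose exponent is at least
    \<open>N\<close>.\<close>
  moreover have B: "fps_cong N B (\<Prod>k<m. 1 + fps_const (inverse w) * fps_X ^ (2 * Suc k))"
    unfolding B_def
  proof (rule fps_cong_prod_extend)
    fix k assume "m \<le> k"
    then have "N \<le> 2 * Suc k" using m n by simp
    then show "fps_cong N (1 + fps_const (inverse w) * fps_X ^ (2 * Suc k)) 1"
      by (rule fps_cong_1_plus)
  qed (simp add: m)
  ultimately have BB': "fps_cong N (fps_const (- w) * B) B'"
    by (simp only:) (rule fps_cong_mult[OF fps_cong_refl B])
  have AB: "A * B = C"
    unfolding A_def B_def C_def prod.distrib[symmetric]
  proof (intro prod.cong refl)
    fix k
    let ?x = "fps_X ^ (2 * Suc k) :: complex fps"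
    have "(1 + fps_const w * ?x) * (1 + fps_const (inverse w) * ?x)
        = 1 + fps_const (w + inverse w) * ?x + fps_const (w * inverse w) * (?x * ?x)"
      by (simp add: algebra_simps fps_const_add[symmetric] fps_const_mult[symmetric]
            del: fps_const_add fps_const_mult mult_Suc_right power_Suc)
    also have "w + inverse w = -1" unfolding cube_root_facts(3) using w by algebra
    also have "w * inverse w = 1" using cube_root_facts(1) by simp
    also have "?x * ?x = fps_X ^ (4 * Suc k)"
      unfolding power_add[symmetric] by (rule arg_cong[of _ _ "power fps_X"]) simp
    finally show "(1 + fps_const w * ?x) * (1 + fps_const (inverse w) * ?x)
        = 1 - ?x + fps_X ^ (4 * Suc k)"
      by (simp flip: fps_const_neg)
  qed
  have DC: "D * C = (\<Prod>k<n. 1 + fps_X ^ (6 * Suc k))"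
    unfolding D_def C_def prod.distrib[symmetric]
  proof (intro prod.cong refl)
    fix k
    let ?x = "fps_X ^ (2 * Suc k) :: complex fps"
    have "fps_X ^ (4 * Suc k) = ?x * ?x" "fps_X ^ (6 * Suc k) = ?x * (?x * ?x)"
      unfolding power_add[symmetric] by (rule arg_cong[of _ _ "power fps_X"], simp)+
    moreover have "(1 + x) * (1 - x + x * x) = 1 + x * (x * x)" for x :: "complex fps"
      by (simp add: algebra_simps)
    ultimately show "(1 + ?x) * (1 - ?x + fps_X ^ (4 * Suc k)) = 1 + fps_X ^ (6 * Suc k)"
      by (simp only:)
  qed
  have OO: "Om * Op = (\<Prod>k<n. 1 - fps_X ^ (2 * (2 * k + 1)))"
    unfolding Om_def Op_def prod.distrib[symmetric]
    by (intro prod.cong refl) (simp add: algebra_simps mult_2 flip: power_add)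
  have "(\<Prod>k<2 * n. 1 - fps_X ^ Suc k) = Om * P"
    unfolding prod_lessThan_double Om_def P_def by simp
  then have "(\<Prod>k<2 * n. 1 - fps_X ^ Suc k) * Q2_prod n n = (Om * Op * D) * (P * C)"
    unfolding Q2_prod_def Op_def[symmetric] DC[symmetric] by (simp add: ac_simps)
  also have "fps_cong N \<dots> (1 * (P * C))"
    unfolding OO D_def using n by (intro fps_cong_mult euler_odd_distinct fps_cong_refl) auto
  also have "1 * (P * C) = fps_const (inverse (- w)) * (P * A * (fps_const (- w) * B))"
  proof -
    have "fps_const (inverse (- w)) * fps_const (- w) = 1"
      using cube_root_facts(1) by simp
    then have "1 * (P * C) = (fps_const (inverse (- w)) * fps_const (- w)) * (P * (A * B))"
      by (simp only: AB)
    then show ?thesis by (simp only: ac_simps)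
  qed
  also have "fps_cong N \<dots> (fps_const (inverse (- w)) * (P * A * B'))"
    by (intro fps_cong_mult BB' fps_cong_refl)
  also have "fps_cong N (fps_const (inverse (- w)) * (P * A * B'))
     (fps_const (inverse (- w)) * (\<Sum>j\<in>{-int n..int n}. fps_const (w powi j) * fps_X ^ (2 * tri j)))"
    \<comment> \<open>Taking \<open>v = 0\<close> makes the third product start at exponent 0, hence
      the detour through \<open>B'\<close>.\<close>
    using triple_product_fps[of w 2 0 N n] n cube_root_facts(1)
    by (intro fps_cong_mult fps_cong_refl) (simp_all add: P_def A_def B'_def)
  finally show ?thesis .
qed

lemma Q2_pentagonal_part1:
  defines "f \<equiv> \<lambda>n j::int. (-1) powi j * real (Q2 (int n - j * (3 * j - 1) div 2))"
  shows "(f (k * (k + 1)) has_sum of_int (rho (int k))) UNIV"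
    and "\<nexists>k::nat. n = k * (k + 1) \<Longrightarrow> (f n has_sum 0) UNIV"
proof -
  define R :: "nat \<Rightarrow> complex fps" where "R M = fps_const (inverse (- w)) *
    (\<Sum>j\<in>{-int (3 * M)..int (3 * M)}. fps_const (w powi j) * fps_X ^ (2 * tri j))" for M
  have *: "(f n has_sum c) UNIV" if "R (2 * n + 3) $ n = of_real c" for n c
  proof -
    let ?M = "2 * n + 3"
    \<comment> \<open>The length 6M is read both as 2 (3M), for the even-odd split, and as 3 (2M),
      for the pentagonal series.\<close>
    have "fps_cong (Suc n) ((\<Prod>k<3 * (2 * ?M). 1 - fps_X ^ (1 * Suc k)) * Q2_prod (3 * ?M) (3 * ?M)) (R ?M)"
      using cube_root_triple_product[of "Suc n" "3 * ?M"] unfolding R_def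
      by (simp add: mult.left_commute[of 3])
    from pentagonal_Q2_has_sum[OF _ _ _ _ _ this that] show ?thesis
      unfolding f_def by simp
  qed
  have R: "R M $ n = inverse (- w) * (\<Sum>j\<in>{j\<in>{-int (3 * M)..int (3 * M)}. int n = j * (j + 1)}. w powi j)"
    for M n
  proof -
    have "2 * tri j = n \<longleftrightarrow> int n = j * (j + 1)" for j
      using int_tri[of j] by linarith
    then show ?thesis
      unfolding R_def by (simp add: fps_sum_monom_nth)
  qed
  have idx: "int k * (int k + 1) = j * (j + 1) \<longleftrightarrow> j = int k \<or> j = - int k - 1" for k j
  proof -
    have "int k * (int k + 1) = j * (j + 1) \<longleftrightarrow> (j - int k) * (j + int k + 1) = 0"
      by (auto simp: algebra_simps)
    then show ?thesis by auto
  qed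
  \<comment> \<open>The two solutions are distinct because \<open>k\<close> is nonnegative, so both
    contribute.\<close>
  have supp: "{j\<in>{-int (3 * M)..int (3 * M)}. int k * (int k + 1) = j * (j + 1)} = {int k, - int k - 1}"
    if "k < M" for M
    using that unfolding idx by auto
  have int_n: "int (k * (k + 1)) = int k * (int k + 1)" by (simp add: algebra_simps)
  have "k < 2 * (k * (k + 1)) + 3" by simp
  from supp[OF this] have "R (2 * (k * (k + 1)) + 3) $ (k * (k + 1)) = inverse (- w) * (w ^ k + w powi (- int k - 1))"
    by (simp only: R int_n) simp
  also have "\<dots> = of_real (of_int (rho (int k)))"
    unfolding cube_root_rho using cube_root_facts(1) by simp
  finally show "(f (k * (k + 1)) has_sum of_int (rho (int k))) UNIV" by (rule *)
  assume n: "\<nexists>k::nat. n = k * (k + 1)"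
  have "int n \<noteq> j * (j + 1)" for j
  proof
    assume j: "int n = j * (j + 1)"
    have "\<exists>k. j = int k \<or> j = - int k - 1"
      \<comment> \<open>Negative \<open>j\<close> is reflected to -j - 1, which leaves j (j + 1)
        unchanged.\<close>
      by (rule exI[of _ "nat (if j \<ge> 0 then j else - j - 1)"]) auto
    then obtain k where "int k * (int k + 1) = j * (j + 1)" using idx by blast
    with j have "int n = int k * (int k + 1)" by simp
    then have "int n = int (k * (k + 1))" by (simp add: algebra_simps)
    then have "n = k * (k + 1)" by (simp only: of_nat_eq_iff)
    then show False using n by blast
  qed
  then show "(f n has_sum 0) UNIV" by (intro *) (simp add: R)
qed

end

section \<open>Part (ii): a theta series to the base X^6\<close>

text \<open>The odd factors of the generating function split into the classes 1, 3, 5 modulo 6.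
  Class 3 cancels against (q^3;q^3) by Euler's identity in q^6; classes 1 and 5 form the triple
  product with \<open>u = 1\<close>, \<open>v = 5\<close>.\<close>

lemma Q2_pentagonal_part2:
  "((\<lambda>j::int. (-1) powi j * real (Q2 (int n - 3 * j * (3 * j - 1) div 2))) has_sum
        (if \<exists>k::int. int n = k * (3 * k - 2) then 1 else 0)) UNIV"
proof -
  define N M m where "N = Suc n" and "M = 2 * N + 1" and "m = 3 * M"
  define R :: "complex fps" where
    "R = (\<Sum>j\<in>{-int m..int m}. fps_const (1 powi j) * fps_X ^ (1 * tri j + 5 * tri (j - 1)))"
  have Nm: "2 * N + 1 \<le> m" by (simp add: m_def M_def)
  define P D :: "complex fps" where
    "P = (\<Prod>k<m. 1 - fps_X ^ (6 * Suc k))" and "D = (\<Prod>k<m. 1 + fps_X ^ (6 * Suc k))"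
  define O1 O3 O5 Om :: "complex fps" where
    "O1 = (\<Prod>k<m. 1 + fps_X ^ (6 * k + 1))" and "O3 = (\<Prod>k<m. 1 + fps_X ^ (6 * k + 3))" and
    "O5 = (\<Prod>k<m. 1 + fps_X ^ (6 * k + 5))" and "Om = (\<Prod>k<m. 1 - fps_X ^ (6 * k + 3))"
  have OO: "Om * O3 = (\<Prod>k<m. 1 - fps_X ^ (6 * (2 * k + 1)))"
    unfolding Om_def O3_def prod.distrib[symmetric]
    by (intro prod.cong refl) (simp add: algebra_simps flip: power_add)
  have "(\<Prod>k<3 * (2 * M). 1 - fps_X ^ (3 * Suc k)) = (\<Prod>k<2 * m. 1 - fps_X ^ (3 * Suc k) :: complex fps)"
    by (simp add: m_def mult.left_commute[of 3])
  also have "\<dots> = Om * P"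
    unfolding prod_lessThan_double Om_def P_def by (simp add: algebra_simps)
  finally have E: "(\<Prod>k<3 * (2 * M). 1 - fps_X ^ (3 * Suc k)) = Om * P" .
  have "2 * (3 * k) + 1 = 6 * k + 1" "2 * (3 * k + 1) + 1 = 6 * k + 3" "2 * (3 * k + 2) + 1 = 6 * k + 5"
    for k :: nat by simp_all
  then have "Q2_prod (3 * m) m = O1 * O3 * O5 * D"
    by (simp only: Q2_prod_def prod_lessThan_triple D_def O1_def O3_def O5_def)
  with E have "(\<Prod>k<3 * (2 * M). 1 - fps_X ^ (3 * Suc k)) * Q2_prod (3 * m) m
      = (Om * O3 * D) * (P * O1 * O5)"
    by (simp only: ac_simps)
  also have "fps_cong N \<dots> (1 * (P * O1 * O5))"
    unfolding OO D_def using Nm by (intro fps_cong_mult euler_odd_distinct fps_cong_refl) auto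
  also have "fps_cong N (1 * (P * O1 * O5)) R"
    using triple_product_fps[of "1 :: complex" 1 5 N m] Nm
    by (simp add: P_def O1_def O5_def R_def add.commute)
  finally have cong: "fps_cong N ((\<Prod>k<3 * (2 * M). 1 - fps_X ^ (3 * Suc k)) * Q2_prod (3 * m) m) R" .
  have "1 * tri j + 5 * tri (j - 1) = n \<longleftrightarrow> int n = j * (3 * j - 2)" for j
    using int_tri[of j] int_tri[of "j - 1"] by (simp add: algebra_simps) linarith
  then have R: "R $ n = (\<Sum>j\<in>{j\<in>{-int m..int m}. int n = j * (3 * j - 2)}. 1)"
    unfolding R_def by (subst fps_sum_monom_nth) simp_all
  have "R $ n = of_real (if \<exists>k::int. int n = k * (3 * k - 2) then 1 else 0)"
  proof (cases "\<exists>k::int. int n = k * (3 * k - 2)")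
    case True
    then obtain k where k: "int n = k * (3 * k - 2)" ..
    have "j = k" if "int n = j * (3 * j - 2)" for j
    proof -
      have "(j - k) * (3 * (j + k) - 2) = 0" using k that by (simp add: algebra_simps)
      \<comment> \<open>It is not divisible by 3. Hence each value k (3k - 2) is attained only
        once.\<close>
      moreover have "3 * (j + k) - 2 \<noteq> 0" by presburger
      ultimately show ?thesis by simp
    qed
    \<comment> \<open>This places \<open>k\<close> inside the truncated summation range.\<close>
    moreover have "\<bar>k\<bar> \<le> int n"
    proof (cases "k = 0")
      case False
      then have "1 \<le> \<bar>3 * k - 2\<bar>" by presburger
      then have "\<bar>k\<bar> * 1 \<le> \<bar>k\<bar> * \<bar>3 * k - 2\<bar>" by (intro mult_left_mono) auto
      then show ?thesis using k by (simp flip: abs_mult)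
    qed simp
    then have "- int m \<le> k" "k \<le> int m" by (auto simp: m_def M_def N_def)
    ultimately have "{j\<in>{-int m..int m}. int n = j * (3 * j - 2)} = {k}" using k by auto
    then show ?thesis unfolding R using True by simp
  qed (simp add: R)
  from pentagonal_Q2_has_sum[OF _ _ _ _ _ cong this]
  have "((\<lambda>j. (-1) powi j * real (Q2 (int n - 3 * (j * (3 * j - 1) div 2)))) has_sum
        (if \<exists>k::int. int n = k * (3 * k - 2) then 1 else 0)) UNIV"
    by (simp add: N_def M_def m_def)
  moreover have "3 * (j * (3 * j - 1) div 2) = 3 * j * (3 * j - 1) div 2" for j :: int
  proof -
    have "even (j * (3 * j - 1))" by simp
    then show ?thesis by (simp only: div_mult_swap mult.assoc)
  qed
  ultimately show ?thesis by simp
qed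

theorem theorem1p14:
  fixes n :: nat
  shows
    "(\<forall>k::nat. n = k * (k + 1) \<longrightarrow>
        ((\<lambda>j::int. (-1) powi j * real (Q2 (int n - j * (3 * j - 1) div 2))) has_sum of_int (rho (int k))) UNIV) \<and>
     ((\<nexists>k::nat. n = k * (k + 1)) \<longrightarrow>
        ((\<lambda>j::int. (-1) powi j * real (Q2 (int n - j * (3 * j - 1) div 2))) has_sum 0) UNIV) \<and>
     ((\<lambda>j::int. (-1) powi j * real (Q2 (int n - 3 * j * (3 * j - 1) div 2))) has_sum
        (if \<exists>k::int. int n = k * (3 * k - 2) then 1 else 0)) UNIV"
proof -
  obtain w :: complex where w: "1 + w + w ^ 2 = 0" by (rule primitive_cube_root)
  show ?thesis
    using Q2_pentagonal_part1[OF w] Q2_pentagonal_part2[of n] by blast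
qed

end
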